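(* Let $q$ be a prime power with $2\nmid q$ and let $n\ge2$ with $\gcd(q,n)=1$. Then $I\neq I^\perp$ for any code (left ideal) $I\subset\mathbb{F}_qD_n$.
   Context: $D_n=\langle a,b\mid a^n=1,\ b^2=1,\ bab=a^{-1}\rangle$ is the dihedral group of order $2n$ and $\mathbb{F}_qD_n$ its group algebra. A code in $\mathbb{F}_qD_n$ is a left ideal. The dot product on $\mathbb{F}_qD_n$ is $\left(\sum_g x_gg,\sum_g y_gg\right)\mapsto\sum_{g\in D_n}x_gy_g\in\mathbb{F}_q$, and $I^\perp=\{x\in\mathbb{F}_qD_n\mid \text{the dot product of } c \text{ and } x \text{ is } 0 \text{ for all } c\in I\}$. *)

theory Defs
  imports
    "HOL-Algebra.Algebra"
    "HOL-Number_Theory.Prime_Powers"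
begin

section \<open>The dihedral group\<close>

text \<open>
  The pair \<open>(i, s)\<close> stands for the normal form \<open>a\<^sup>i b\<^sup>s\<close>, where \<open>0 \<le> i < n\<close> and \<open>s\<close> is read
  as an exponent in \<open>{0, 1}\<close>. The multiplication comes from \<open>b a\<^sup>j = a\<^sup>-\<^sup>j b\<close>.
  That this is the group with the presentation \<open>a\<^sup>n = 1, b\<^sup>2 = 1, b a b = a\<^sup>-\<^sup>1\<close> is the content of
  the lemmas \<open>dihedral_relations\<close>, \<open>dihedral_generate\<close> and \<open>dihedral_universal\<close> below.
\<close>

definition dihedral :: "nat \<Rightarrow> (int \<times> bool) monoid" where
  "dihedral n =
    \<lparr> carrier = {0..<int n} \<times> UNIV,
      monoid.mult = (\<lambda>(i, s) (j, t). ((i + (if s then - j else j)) mod int n, s \<noteq> t)),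
      one = (0, False) \<rparr>"

definition dihedral_a :: "nat \<Rightarrow> int \<times> bool" where
  "dihedral_a n = (1 mod int n, False)"

definition dihedral_b :: "int \<times> bool" where
  "dihedral_b = (0, True)"

lemma finite_dihedral: "finite (carrier (dihedral n))"
  by (simp add: dihedral_def)

lemma order_dihedral: "order (dihedral n) = 2 * n"
  by (simp add: dihedral_def order_def card_cartesian_product)

lemma group_dihedral:
  assumes "n > 0"
  shows "group (dihedral n)"
proof (rule groupI)
  fix x y z
  assume "x \<in> carrier (dihedral n)" "y \<in> carrier (dihedral n)" "z \<in> carrier (dihedral n)"
  obtain i s j t k u where [simp]: "x = (i, s)" "y = (j, t)" "z = (k, u)"
    by (cases x; cases y; cases z)
  show "x \<otimes>\<^bsub>dihedral n\<^esub> y \<otimes>\<^bsub>dihedral n\<^esub> z = x \<otimes>\<^bsub>dihedral n\<^esub> (y \<otimes>\<^bsub>dihedral n\<^esub> z)"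
    by (cases s; cases t) (simp_all add: dihedral_def mod_simps add.commute add.left_commute diff_diff_eq diff_diff_eq2 diff_add_eq)
next
  fix x assume x: "x \<in> carrier (dihedral n)"
  obtain i s where [simp]: "x = (i, s)" by (cases x)
  show "\<exists>y\<in>carrier (dihedral n). y \<otimes>\<^bsub>dihedral n\<^esub> x = \<one>\<^bsub>dihedral n\<^esub>"
    by (rule bexI[of _ "((if s then i else - i) mod int n, s)"])
      (use assms in \<open>auto simp: dihedral_def mod_simps\<close>)
qed (use assms in \<open>auto simp: dihedral_def\<close>)

lemma dihedral_a_closed: "n > 0 \<Longrightarrow> dihedral_a n \<in> carrier (dihedral n)"
  and dihedral_b_closed: "n > 0 \<Longrightarrow> dihedral_b \<in> carrier (dihedral n)"
  by (auto simp: dihedral_def dihedral_a_def dihedral_b_def)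

lemma dihedral_a_pow:
  "dihedral_a n [^]\<^bsub>dihedral n\<^esub> (k::nat) = (int k mod int n, False)"
  by (induction k) (auto simp: dihedral_def dihedral_a_def mod_simps nat_pow_def algebra_simps)

lemma dihedral_relations:
  assumes "n > 0"
  shows "dihedral_a n [^]\<^bsub>dihedral n\<^esub> n = \<one>\<^bsub>dihedral n\<^esub>"
    and "dihedral_b [^]\<^bsub>dihedral n\<^esub> (2::nat) = \<one>\<^bsub>dihedral n\<^esub>"
    and "dihedral_b \<otimes>\<^bsub>dihedral n\<^esub> dihedral_a n \<otimes>\<^bsub>dihedral n\<^esub> dihedral_b
          = inv\<^bsub>dihedral n\<^esub> dihedral_a n"
proof -
  interpret group "dihedral n" using assms by (rule group_dihedral)
  show "dihedral_a n [^]\<^bsub>dihedral n\<^esub> n = \<one>\<^bsub>dihedral n\<^esub>"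
    by (simp add: dihedral_a_pow) (simp add: dihedral_def)
  show "dihedral_b [^]\<^bsub>dihedral n\<^esub> (2::nat) = \<one>\<^bsub>dihedral n\<^esub>"
    by (simp add: dihedral_b_def dihedral_def numeral_2_eq_2 nat_pow_def)
  have "(dihedral_b \<otimes>\<^bsub>dihedral n\<^esub> dihedral_a n \<otimes>\<^bsub>dihedral n\<^esub> dihedral_b)
          \<otimes>\<^bsub>dihedral n\<^esub> dihedral_a n = \<one>\<^bsub>dihedral n\<^esub>"
    by (simp add: dihedral_a_def dihedral_b_def dihedral_def mod_simps)
  then show "dihedral_b \<otimes>\<^bsub>dihedral n\<^esub> dihedral_a n \<otimes>\<^bsub>dihedral n\<^esub> dihedral_b
          = inv\<^bsub>dihedral n\<^esub> dihedral_a n"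
    using inv_equality[symmetric] dihedral_a_closed[OF assms] dihedral_b_closed[OF assms]
    by (metis m_closed)
qed

lemma dihedral_normal_form:
  assumes "i \<in> {0..<int n}"
  shows "(i, s) = dihedral_a n [^]\<^bsub>dihedral n\<^esub> nat i
           \<otimes>\<^bsub>dihedral n\<^esub> (if s then dihedral_b else \<one>\<^bsub>dihedral n\<^esub>)"
  using assms by (simp add: dihedral_a_pow) (auto simp: dihedral_def dihedral_b_def)

lemma dihedral_generate:
  assumes "n > 0"
  shows "generate (dihedral n) {dihedral_a n, dihedral_b} = carrier (dihedral n)"
proof
  interpret group "dihedral n" using assms by (rule group_dihedral)
  have ab: "{dihedral_a n, dihedral_b} \<subseteq> carrier (dihedral n)"
    using dihedral_a_closed dihedral_b_closed assms by simp
  show "generate (dihedral n) {dihedral_a n, dihedral_b} \<subseteq> carrier (dihedral n)"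
    using generate_incl[OF ab] .
  show "carrier (dihedral n) \<subseteq> generate (dihedral n) {dihedral_a n, dihedral_b}"
  proof
    fix x assume "x \<in> carrier (dihedral n)"
    then obtain i s where x: "x = (i, s)" "i \<in> {0..<int n}"
      by (auto simp: dihedral_def)
    have "dihedral_a n [^]\<^bsub>dihedral n\<^esub> (k::nat) \<in> generate (dihedral n) {dihedral_a n, dihedral_b}"
      for k by (induction k) (auto intro: generate.intros)
    then show "x \<in> generate (dihedral n) {dihedral_a n, dihedral_b}"
      unfolding x(1) dihedral_normal_form[OF x(2)]
      by (intro generate.eng) (auto intro: generate.intros)
  qed
qed

lemma dihedral_universal:
  fixes H (structure)
  assumes "n > 0" and "group H" and x: "x \<in> carrier H" and y: "y \<in> carrier H"
    and xn: "x [^] n = \<one>" and y2: "y [^] (2::nat) = \<one>" and yxy: "y \<otimes> x \<otimes> y = inv x"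
  shows "\<exists>h \<in> hom (dihedral n) H. h (dihedral_a n) = x \<and> h dihedral_b = y"
proof -
  interpret group H by fact
  define h where "h = (\<lambda>(i::int, s). x [^] i \<otimes> (if s then y else \<one>))"
  have yy: "y \<otimes> y = \<one>"
    using y2 y by (simp add: numeral_2_eq_2)
  have mod: "x [^] (i mod int n) = x [^] i" for i
  proof -
    have "x [^] i = x [^] (int n * (i div int n) + i mod int n)" by simp
    also have "\<dots> = (x [^] int n) [^] (i div int n) \<otimes> x [^] (i mod int n)"
      using x by (simp only: int_pow_mult int_pow_pow)
    also have "\<dots> = x [^] (i mod int n)"
      using x xn by (simp add: int_pow_int)
    finally show ?thesis by simp
  qed
  have yx: "y \<otimes> x = inv x \<otimes> y"
    using yxy yy x y by (metis m_assoc m_closed r_one)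
  have swapn: "y \<otimes> x [^] (k::nat) = inv x [^] k \<otimes> y" for k
  proof (induction k)
    case (Suc k)
    have "y \<otimes> x [^] Suc k = y \<otimes> x [^] k \<otimes> x" using x y by (simp add: m_assoc)
    also have "\<dots> = inv x [^] k \<otimes> (y \<otimes> x)" using x y Suc by (simp add: m_assoc)
    also have "\<dots> = inv x [^] Suc k \<otimes> y" using x y yx by (simp add: m_assoc)
    finally show ?case .
  qed (use y in simp)
  have swap: "y \<otimes> x [^] (j::int) = x [^] (- j) \<otimes> y" for j
  proof -
    have "y \<otimes> x [^] j = y \<otimes> x [^] nat (j mod int n)"
      using assms(1) mod[of j] int_pow_int[of H x "nat (j mod int n)"] by simp
    also have "\<dots> = x [^] (- (j mod int n)) \<otimes> y"
      using assms(1) x swapn[of "nat (j mod int n)"]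
        int_pow_neg_int[OF x, of "nat (j mod int n)"] nat_pow_inv[OF x] by simp
    also have "x [^] (- (j mod int n)) = x [^] (- j)"
      using mod[of "- (j mod int n)"] mod[of "- j"] by (simp add: mod_simps)
    finally show ?thesis .
  qed
  have "h \<in> hom (dihedral n) H"
  proof (rule homI)
    fix u assume "u \<in> carrier (dihedral n)"
    then show "h u \<in> carrier H" using x y by (auto simp: h_def split: prod.splits)
  next
    fix u v :: "int \<times> bool"
    obtain i s j t where [simp]: "u = (i, s)" "v = (j, t)" by (cases u; cases v)
    show "h (u \<otimes>\<^bsub>dihedral n\<^esub> v) = h u \<otimes> h v"
    proof (cases s)
      case False
      then show ?thesis
        using x y by (auto simp: h_def dihedral_def mod int_pow_mult m_assoc)
    next
      case True
      have "h u \<otimes> h v = x [^] i \<otimes> (y \<otimes> x [^] j) \<otimes> (if t then y else \<one>)"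
        using True x y by (simp add: h_def m_assoc)
      also have "\<dots> = x [^] (i - j) \<otimes> (y \<otimes> (if t then y else \<one>))"
        using x y int_pow_mult[OF x, of i "- j"] by (simp add: swap m_assoc)
      finally show ?thesis
        using True x y yy by (auto simp: h_def dihedral_def mod)
    qed
  qed
  moreover have "h (dihedral_a n) = x" "h dihedral_b = y"
    using x y by (auto simp: h_def dihedral_a_def dihedral_b_def mod)
  ultimately show ?thesis by blast
qed


section \<open>The group algebra of a finite group\<close>

text \<open>
  The element \<open>\<Sum>g. x\<^sub>g g\<close> is represented by its coefficient function \<open>g \<mapsto> x\<^sub>g\<close>. For infinite
  \<open>G\<close> the carrier would be too large and the sums would be meaningless.
\<close>

definition group_algebra ::
    "('a, 'c) ring_scheme \<Rightarrow> ('g, 'd) monoid_scheme \<Rightarrow> ('g \<Rightarrow> 'a) ring" where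
  "group_algebra F G =
    \<lparr> carrier = carrier G \<rightarrow>\<^sub>E carrier F,
      monoid.mult = (\<lambda>x y. \<lambda>g\<in>carrier G. \<Oplus>\<^bsub>F\<^esub>h\<in>carrier G. x h \<otimes>\<^bsub>F\<^esub> y (inv\<^bsub>G\<^esub> h \<otimes>\<^bsub>G\<^esub> g)),
      one = (\<lambda>g\<in>carrier G. if g = \<one>\<^bsub>G\<^esub> then \<one>\<^bsub>F\<^esub> else \<zero>\<^bsub>F\<^esub>),
      ring.zero = (\<lambda>g\<in>carrier G. \<zero>\<^bsub>F\<^esub>),
      ring.add = (\<lambda>x y. \<lambda>g\<in>carrier G. x g \<oplus>\<^bsub>F\<^esub> y g) \<rparr>"

lemma (in abelian_monoid) finsum_swap:
  assumes "finite A" "finite B" "\<And>i j. i \<in> A \<Longrightarrow> j \<in> B \<Longrightarrow> f i j \<in> carrier G"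
  shows "(\<Oplus>i\<in>A. \<Oplus>j\<in>B. f i j) = (\<Oplus>j\<in>B. \<Oplus>i\<in>A. f i j)"
  using assms(1,3)
proof (induction A rule: finite_induct)
  case (insert a A)
  have "(\<Oplus>i\<in>insert a A. \<Oplus>j\<in>B. f i j) = (\<Oplus>j\<in>B. f a j) \<oplus> (\<Oplus>i\<in>A. \<Oplus>j\<in>B. f i j)"
    using insert by (intro finsum_insert) (auto intro!: finsum_closed)
  also have "\<dots> = (\<Oplus>j\<in>B. f a j \<oplus> (\<Oplus>i\<in>A. f i j))"
    using insert by (subst finsum_addf) (auto intro!: finsum_closed)
  also have "\<dots> = (\<Oplus>j\<in>B. \<Oplus>i\<in>insert a A. f i j)"
    using insert by (intro finsum_cong') (auto intro!: finsum_closed finsum_insert[symmetric])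
  finally show ?case .
qed simp

lemma ring_group_algebra:
  assumes "ring F" "group G" and fin: "finite (carrier G)"
  shows "ring (group_algebra F G)"
proof -
  interpret F: ring F by fact
  interpret G: group G by fact
  let ?A = "group_algebra F G"
  have val: "x g \<in> carrier F" if "x \<in> carrier ?A" "g \<in> carrier G" for x g
    using that by (auto simp: group_algebra_def)
  have ext: "x = y" if "x \<in> carrier ?A" "y \<in> carrier ?A" "\<And>g. g \<in> carrier G \<Longrightarrow> x g = y g" for x y
    using that by (auto simp: group_algebra_def intro: PiE_ext)
  have add: "(x \<oplus>\<^bsub>?A\<^esub> y) g = x g \<oplus>\<^bsub>F\<^esub> y g" if "g \<in> carrier G" for x y g
    using that by (simp add: group_algebra_def)
  have zero: "\<zero>\<^bsub>?A\<^esub> g = \<zero>\<^bsub>F\<^esub>" if "g \<in> carrier G" for g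
    using that by (simp add: group_algebra_def)
  have one: "\<one>\<^bsub>?A\<^esub> g = (if g = \<one>\<^bsub>G\<^esub> then \<one>\<^bsub>F\<^esub> else \<zero>\<^bsub>F\<^esub>)" if "g \<in> carrier G" for g
    using that by (simp add: group_algebra_def)
  have mult: "(x \<otimes>\<^bsub>?A\<^esub> y) g = (\<Oplus>\<^bsub>F\<^esub>h\<in>carrier G. x h \<otimes>\<^bsub>F\<^esub> y (inv\<^bsub>G\<^esub> h \<otimes>\<^bsub>G\<^esub> g))"
    if "g \<in> carrier G" for x y g
    using that by (simp add: group_algebra_def)
  have add_cl: "x \<oplus>\<^bsub>?A\<^esub> y \<in> carrier ?A" if "x \<in> carrier ?A" "y \<in> carrier ?A" for x y
    using val[OF that(1)] val[OF that(2)] by (auto simp: group_algebra_def)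
  have mult_cl: "x \<otimes>\<^bsub>?A\<^esub> y \<in> carrier ?A" if "x \<in> carrier ?A" "y \<in> carrier ?A" for x y
    using val[OF that(1)] val[OF that(2)]
    by (auto simp: group_algebra_def intro!: F.finsum_closed)
  have zero_cl: "\<zero>\<^bsub>?A\<^esub> \<in> carrier ?A" and one_cl: "\<one>\<^bsub>?A\<^esub> \<in> carrier ?A"
    by (auto simp: group_algebra_def)
  have neg: "\<exists>y\<in>carrier ?A. y \<oplus>\<^bsub>?A\<^esub> x = \<zero>\<^bsub>?A\<^esub>" if x: "x \<in> carrier ?A" for x
  proof -
    define y where "y = (\<lambda>g\<in>carrier G. \<ominus>\<^bsub>F\<^esub> x g)"
    have y: "y \<in> carrier ?A" using val[OF x] by (auto simp: y_def group_algebra_def)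
    have "y \<oplus>\<^bsub>?A\<^esub> x = \<zero>\<^bsub>?A\<^esub>"
      by (rule ext[OF add_cl[OF y x] zero_cl])
        (simp add: add zero y_def val[OF x] F.l_neg)
    then show ?thesis using y by blast
  qed
  have shift: "(\<Oplus>\<^bsub>F\<^esub>h\<in>carrier G. f h) = (\<Oplus>\<^bsub>F\<^esub>m\<in>carrier G. f (k \<otimes>\<^bsub>G\<^esub> m))"
    if "k \<in> carrier G" "f \<in> carrier G \<rightarrow> carrier F" for k f
    using F.finsum_reindex[of f "\<lambda>m. k \<otimes>\<^bsub>G\<^esub> m" "carrier G"] that
    by (simp add: G.surj_const_mult G.inj_on_cmult)
  have delta: "(\<Oplus>\<^bsub>F\<^esub>h\<in>carrier G. if h = k then f h else \<zero>\<^bsub>F\<^esub>) = f k"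
    if "k \<in> carrier G" "f \<in> carrier G \<rightarrow> carrier F" for k f
    using F.add.finprod_singleton_swap[OF that(1) fin that(2)] by (simp add: finsum_def)
  have l_one: "\<one>\<^bsub>?A\<^esub> \<otimes>\<^bsub>?A\<^esub> x = x" if x: "x \<in> carrier ?A" for x
  proof (rule ext[OF mult_cl[OF one_cl x] x])
    fix g assume g: "g \<in> carrier G"
    have "(\<one>\<^bsub>?A\<^esub> \<otimes>\<^bsub>?A\<^esub> x) g
        = (\<Oplus>\<^bsub>F\<^esub>h\<in>carrier G. if h = \<one>\<^bsub>G\<^esub> then x (inv\<^bsub>G\<^esub> h \<otimes>\<^bsub>G\<^esub> g) else \<zero>\<^bsub>F\<^esub>)"
      unfolding mult[OF g] by (rule F.finsum_cong') (auto simp: one val[OF x] g)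
    also have "\<dots> = x g" using g val[OF x] by (subst delta) auto
    finally show "(\<one>\<^bsub>?A\<^esub> \<otimes>\<^bsub>?A\<^esub> x) g = x g" .
  qed
  have r_one: "x \<otimes>\<^bsub>?A\<^esub> \<one>\<^bsub>?A\<^esub> = x" if x: "x \<in> carrier ?A" for x
  proof (rule ext[OF mult_cl[OF x one_cl] x])
    fix g assume g: "g \<in> carrier G"
    have eq: "inv\<^bsub>G\<^esub> h \<otimes>\<^bsub>G\<^esub> g = \<one>\<^bsub>G\<^esub> \<longleftrightarrow> h = g" if "h \<in> carrier G" for h
      using that g by (metis G.inv_closed G.inv_inv G.inv_equality G.r_inv G.l_inv)
    have "(x \<otimes>\<^bsub>?A\<^esub> \<one>\<^bsub>?A\<^esub>) g = (\<Oplus>\<^bsub>F\<^esub>h\<in>carrier G. if h = g then x h else \<zero>\<^bsub>F\<^esub>)"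
      unfolding mult[OF g] by (rule F.finsum_cong') (auto simp: one val[OF x] g eq)
    also have "\<dots> = x g" using g val[OF x] by (subst delta) auto
    finally show "(x \<otimes>\<^bsub>?A\<^esub> \<one>\<^bsub>?A\<^esub>) g = x g" .
  qed
  have assoc: "x \<otimes>\<^bsub>?A\<^esub> y \<otimes>\<^bsub>?A\<^esub> z = x \<otimes>\<^bsub>?A\<^esub> (y \<otimes>\<^bsub>?A\<^esub> z)"
    if x: "x \<in> carrier ?A" and y: "y \<in> carrier ?A" and z: "z \<in> carrier ?A" for x y z
  proof (rule ext[OF mult_cl[OF mult_cl[OF x y] z] mult_cl[OF x mult_cl[OF y z]]])
    fix g assume g: "g \<in> carrier G"
    note v = val[OF x] val[OF y] val[OF z]
    have "(x \<otimes>\<^bsub>?A\<^esub> y \<otimes>\<^bsub>?A\<^esub> z) g = (\<Oplus>\<^bsub>F\<^esub>h\<in>carrier G. \<Oplus>\<^bsub>F\<^esub>k\<in>carrier G.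
        x k \<otimes>\<^bsub>F\<^esub> y (inv\<^bsub>G\<^esub> k \<otimes>\<^bsub>G\<^esub> h) \<otimes>\<^bsub>F\<^esub> z (inv\<^bsub>G\<^esub> h \<otimes>\<^bsub>G\<^esub> g))"
      unfolding mult[OF g]
      by (rule F.finsum_cong')
        (auto simp: mult g v fin intro!: F.finsum_closed F.finsum_ldistr)
    also have "\<dots> = (\<Oplus>\<^bsub>F\<^esub>k\<in>carrier G. \<Oplus>\<^bsub>F\<^esub>h\<in>carrier G.
        x k \<otimes>\<^bsub>F\<^esub> y (inv\<^bsub>G\<^esub> k \<otimes>\<^bsub>G\<^esub> h) \<otimes>\<^bsub>F\<^esub> z (inv\<^bsub>G\<^esub> h \<otimes>\<^bsub>G\<^esub> g))"
      by (rule F.finsum_swap) (auto simp: fin v g)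
    also have "\<dots> = (x \<otimes>\<^bsub>?A\<^esub> (y \<otimes>\<^bsub>?A\<^esub> z)) g"
      unfolding mult[OF g]
    proof (rule F.finsum_cong'[OF refl])
      fix k assume k: "k \<in> carrier G"
      have "(\<Oplus>\<^bsub>F\<^esub>h\<in>carrier G.
            x k \<otimes>\<^bsub>F\<^esub> y (inv\<^bsub>G\<^esub> k \<otimes>\<^bsub>G\<^esub> h) \<otimes>\<^bsub>F\<^esub> z (inv\<^bsub>G\<^esub> h \<otimes>\<^bsub>G\<^esub> g))
          = (\<Oplus>\<^bsub>F\<^esub>m\<in>carrier G. x k \<otimes>\<^bsub>F\<^esub> y (inv\<^bsub>G\<^esub> k \<otimes>\<^bsub>G\<^esub> (k \<otimes>\<^bsub>G\<^esub> m))
              \<otimes>\<^bsub>F\<^esub> z (inv\<^bsub>G\<^esub> (k \<otimes>\<^bsub>G\<^esub> m) \<otimes>\<^bsub>G\<^esub> g))"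
        by (rule shift[OF k]) (auto simp: v k g)
      also have "\<dots> = (\<Oplus>\<^bsub>F\<^esub>m\<in>carrier G.
          x k \<otimes>\<^bsub>F\<^esub> (y m \<otimes>\<^bsub>F\<^esub> z (inv\<^bsub>G\<^esub> m \<otimes>\<^bsub>G\<^esub> (inv\<^bsub>G\<^esub> k \<otimes>\<^bsub>G\<^esub> g))))"
        by (rule F.finsum_cong')
          (auto simp: v k g G.m_assoc[symmetric] G.inv_mult_group F.m_assoc)
      also have "\<dots> = x k \<otimes>\<^bsub>F\<^esub> (y \<otimes>\<^bsub>?A\<^esub> z) (inv\<^bsub>G\<^esub> k \<otimes>\<^bsub>G\<^esub> g)"
        using k g by (subst mult) (auto simp: v fin intro!: F.finsum_rdistr[symmetric])
      finally show "(\<Oplus>\<^bsub>F\<^esub>h\<in>carrier G.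
            x k \<otimes>\<^bsub>F\<^esub> y (inv\<^bsub>G\<^esub> k \<otimes>\<^bsub>G\<^esub> h) \<otimes>\<^bsub>F\<^esub> z (inv\<^bsub>G\<^esub> h \<otimes>\<^bsub>G\<^esub> g))
          = x k \<otimes>\<^bsub>F\<^esub> (y \<otimes>\<^bsub>?A\<^esub> z) (inv\<^bsub>G\<^esub> k \<otimes>\<^bsub>G\<^esub> g)" .
    qed (use g v val[OF mult_cl[OF y z]] in auto)
    finally show "(x \<otimes>\<^bsub>?A\<^esub> y \<otimes>\<^bsub>?A\<^esub> z) g = (x \<otimes>\<^bsub>?A\<^esub> (y \<otimes>\<^bsub>?A\<^esub> z)) g" .
  qed
  show ?thesis
  proof (rule ringI)
    show "abelian_group ?A"
    proof (rule abelian_groupI)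
      fix x y z assume x: "x \<in> carrier ?A" and y: "y \<in> carrier ?A" and z: "z \<in> carrier ?A"
      show "x \<oplus>\<^bsub>?A\<^esub> y \<oplus>\<^bsub>?A\<^esub> z = x \<oplus>\<^bsub>?A\<^esub> (y \<oplus>\<^bsub>?A\<^esub> z)"
        by (rule ext[OF add_cl[OF add_cl[OF x y] z] add_cl[OF x add_cl[OF y z]]])
          (simp add: add val x y z F.a_assoc)
    next
      fix x y assume x: "x \<in> carrier ?A" and y: "y \<in> carrier ?A"
      show "x \<oplus>\<^bsub>?A\<^esub> y = y \<oplus>\<^bsub>?A\<^esub> x"
        by (rule ext[OF add_cl[OF x y] add_cl[OF y x]]) (simp add: add val x y F.a_comm)
    next
      fix x assume x: "x \<in> carrier ?A"
      show "\<zero>\<^bsub>?A\<^esub> \<oplus>\<^bsub>?A\<^esub> x = x"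
        by (rule ext[OF add_cl[OF zero_cl x] x]) (simp add: add zero val x)
    qed (use add_cl zero_cl neg in auto)
    show "monoid ?A"
      by (rule monoidI) (use mult_cl one_cl assoc l_one r_one in auto)
  next
    fix x y z assume x: "x \<in> carrier ?A" and y: "y \<in> carrier ?A" and z: "z \<in> carrier ?A"
    note v = val[OF x] val[OF y] val[OF z]
    show "(x \<oplus>\<^bsub>?A\<^esub> y) \<otimes>\<^bsub>?A\<^esub> z = x \<otimes>\<^bsub>?A\<^esub> z \<oplus>\<^bsub>?A\<^esub> y \<otimes>\<^bsub>?A\<^esub> z"
    proof (rule ext[OF mult_cl[OF add_cl[OF x y] z] add_cl[OF mult_cl[OF x z] mult_cl[OF y z]]])
      fix g assume g: "g \<in> carrier G"
      show "((x \<oplus>\<^bsub>?A\<^esub> y) \<otimes>\<^bsub>?A\<^esub> z) g = (x \<otimes>\<^bsub>?A\<^esub> z \<oplus>\<^bsub>?A\<^esub> y \<otimes>\<^bsub>?A\<^esub> z) g"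
        unfolding add[OF g] mult[OF g]
        by (subst F.finsum_addf[symmetric]; (rule F.finsum_cong')?)
          (auto simp: v g add F.l_distr)
    qed
    show "z \<otimes>\<^bsub>?A\<^esub> (x \<oplus>\<^bsub>?A\<^esub> y) = z \<otimes>\<^bsub>?A\<^esub> x \<oplus>\<^bsub>?A\<^esub> z \<otimes>\<^bsub>?A\<^esub> y"
    proof (rule ext[OF mult_cl[OF z add_cl[OF x y]] add_cl[OF mult_cl[OF z x] mult_cl[OF z y]]])
      fix g assume g: "g \<in> carrier G"
      show "(z \<otimes>\<^bsub>?A\<^esub> (x \<oplus>\<^bsub>?A\<^esub> y)) g = (z \<otimes>\<^bsub>?A\<^esub> x \<oplus>\<^bsub>?A\<^esub> z \<otimes>\<^bsub>?A\<^esub> y) g"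
        unfolding add[OF g] mult[OF g]
        by (subst F.finsum_addf[symmetric]; (rule F.finsum_cong')?)
          (auto simp: v g add F.r_distr)
    qed
  qed
qed


section \<open>Left ideals and duals\<close>

locale left_ideal = additive_subgroup I R + ring R for I and R (structure) +
  assumes I_l_closed: "\<lbrakk>a \<in> I; x \<in> carrier R\<rbrakk> \<Longrightarrow> x \<otimes> a \<in> I"

definition dot ::
    "('a, 'c) ring_scheme \<Rightarrow> ('g, 'd) monoid_scheme \<Rightarrow> ('g \<Rightarrow> 'a) \<Rightarrow> ('g \<Rightarrow> 'a) \<Rightarrow> 'a" where
  "dot F G x y = (\<Oplus>\<^bsub>F\<^esub>g\<in>carrier G. x g \<otimes>\<^bsub>F\<^esub> y g)"

definition dual ::
    "('a, 'c) ring_scheme \<Rightarrow> ('g, 'd) monoid_scheme \<Rightarrow> ('g \<Rightarrow> 'a) set \<Rightarrow> ('g \<Rightarrow> 'a) set" where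
  "dual F G I = {x \<in> carrier (group_algebra F G). \<forall>c\<in>I. dot F G c x = \<zero>\<^bsub>F\<^esub>}"

end

theory Submission
  imports Defs
begin

text \<open>
  The obstruction is the trivial representation, spanned in the group algebra by the sum \<open>s\<close> of
  all group elements, that is, by the constant coefficient function \<open>1\<close>. For every \<open>c\<close> one has
  \<open>s c = t s\<close>, where \<open>t\<close> is the sum of the coefficients of \<open>c\<close>, and \<open>t\<close> is also the dot product
  of \<open>c\<close> with \<open>s\<close>. So either some element of the left ideal \<open>I\<close> has \<open>t \<noteq> 0\<close>, and then \<open>s \<in> I\<close>,
  or \<open>s\<close> is orthogonal to all of \<open>I\<close>. If \<open>I\<close> equals its dual, both cases give \<open>s \<in> I\<close>, and
  then \<open>s\<close> is orthogonal to itself. But the dot product of \<open>s\<close> with itself is the order of the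
  group.

  This excludes self-dual left ideals over any finite group whose order is nonzero in the
  field. For the dihedral group the order is \<open>2n\<close>, which is prime to \<open>q\<close>, and by Lagrange's
  theorem in the additive group of the field an integer prime to \<open>q\<close> cannot vanish there.
\<close>

lemma (in group) finsum_translate_inv:
  assumes "abelian_monoid F" and f: "f \<in> carrier G \<rightarrow> carrier F" and g: "g \<in> carrier G"
  shows "(\<Oplus>\<^bsub>F\<^esub>h\<in>carrier G. f (inv h \<otimes> g)) = (\<Oplus>\<^bsub>F\<^esub>h\<in>carrier G. f h)"
proof -
  interpret F: abelian_monoid F by fact
  have inv: "inv (g \<otimes> inv k) \<otimes> g = k" "g \<otimes> inv (inv k \<otimes> g) = k" if "k \<in> carrier G" for k
    using that g by (simp_all add: inv_mult_group m_assoc) (simp add: m_assoc[symmetric])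
  have "bij_betw (\<lambda>h. inv h \<otimes> g) (carrier G) (carrier G)"
    by (rule bij_betw_byWitness[where f' = "\<lambda>k. g \<otimes> inv k"]) (use g inv in auto)
  then show ?thesis
    using F.finsum_reindex[of f "\<lambda>h. inv h \<otimes> g" "carrier G"] f
    by (simp add: bij_betw_def)
qed

lemma left_ideal_neq_dual:
  fixes F :: "('a, 'c) ring_scheme" and G :: "('g, 'd) monoid_scheme"
  assumes "field F" and "group G" and ideal: "left_ideal I (group_algebra F G)"
    and order: "[order G] \<cdot>\<^bsub>F\<^esub> \<one>\<^bsub>F\<^esub> \<noteq> \<zero>\<^bsub>F\<^esub>"
  shows "I \<noteq> dual F G I"
proof
  assume self_dual: "I = dual F G I"
  interpret F: field F by fact
  interpret G: group G by fact
  interpret I: left_ideal I "group_algebra F G" by fact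
  define s where "s = (\<lambda>g\<in>carrier G. \<one>\<^bsub>F\<^esub>)"
  have s_carrier: "s \<in> carrier (group_algebra F G)"
    by (simp add: s_def group_algebra_def)
  have coeff: "c \<in> carrier G \<rightarrow> carrier F" if "c \<in> I" for c
    using I.a_subset that by (auto simp: group_algebra_def)
  have dot_s: "dot F G c s = (\<Oplus>\<^bsub>F\<^esub>g\<in>carrier G. c g)" if "c \<in> carrier G \<rightarrow> carrier F" for c
    unfolding dot_def by (rule F.finsum_cong') (use that in \<open>auto simp: s_def Pi_iff\<close>)
  have "s \<in> I"
  proof (cases "\<forall>c\<in>I. dot F G c s = \<zero>\<^bsub>F\<^esub>")
    case True
    then have "s \<in> dual F G I" using s_carrier by (simp add: dual_def)
    then show ?thesis using self_dual by simp
  next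
    case False
    then obtain c where c: "c \<in> I" and t: "dot F G c s \<noteq> \<zero>\<^bsub>F\<^esub>" by blast
    note c_coeff = coeff[OF c]
    define t where "t = (\<Oplus>\<^bsub>F\<^esub>g\<in>carrier G. c g)"
    have t_unit: "t \<in> Units F"
      using t c_coeff by (simp add: t_def dot_s F.field_Units)
    \<comment> \<open>The rescaled all-ones element \<open>t\<^sup>-\<^sup>1 s\<close> multiplies \<open>c\<close> to \<open>s\<close>.\<close>
    define x where "x = (\<lambda>g\<in>carrier G. inv\<^bsub>F\<^esub> t)"
    have x: "x \<in> carrier (group_algebra F G)"
      using t_unit by (simp add: x_def group_algebra_def)
    have "x \<otimes>\<^bsub>group_algebra F G\<^esub> c = s"
    proof (rule ext)
      fix g
      show "(x \<otimes>\<^bsub>group_algebra F G\<^esub> c) g = s g"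
      proof (cases "g \<in> carrier G")
        case g: True
        have fin: "finite (carrier G)"
        \<comment> \<open>An infinite group has order \<open>0\<close> by convention, contrary to \<open>order\<close>.\<close>
        proof (rule ccontr)
          assume "infinite (carrier G)"
          then show False using order by (simp add: order_def)
        qed
        have "(x \<otimes>\<^bsub>group_algebra F G\<^esub> c) g
            = (\<Oplus>\<^bsub>F\<^esub>h\<in>carrier G. inv\<^bsub>F\<^esub> t \<otimes>\<^bsub>F\<^esub> c (inv\<^bsub>G\<^esub> h \<otimes>\<^bsub>G\<^esub> g))"
          using g c_coeff t_unit
          by (auto simp: group_algebra_def x_def intro!: F.finsum_cong')
        also have "\<dots> = inv\<^bsub>F\<^esub> t \<otimes>\<^bsub>F\<^esub> (\<Oplus>\<^bsub>F\<^esub>h\<in>carrier G. c (inv\<^bsub>G\<^esub> h \<otimes>\<^bsub>G\<^esub> g))"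
          using fin g c_coeff t_unit by (intro F.finsum_rdistr[symmetric]) auto
        also have "\<dots> = inv\<^bsub>F\<^esub> t \<otimes>\<^bsub>F\<^esub> t"
          unfolding t_def
          using G.finsum_translate_inv[OF F.abelian_monoid_axioms c_coeff g] by simp
        finally show ?thesis using t_unit g by (simp add: s_def)
      next
        case False
        then show ?thesis by (simp add: group_algebra_def s_def)
      qed
    qed
    then show ?thesis using I.I_l_closed[OF c x] by simp
  qed
  then have "dot F G s s = \<zero>\<^bsub>F\<^esub>"
    using self_dual by (auto simp: dual_def)
  moreover have "dot F G s s = (\<Oplus>\<^bsub>F\<^esub>g\<in>carrier G. \<one>\<^bsub>F\<^esub>)"
    by (subst dot_s) (auto simp: s_def intro!: F.finsum_cong')
  moreover have "\<dots> = [order G] \<cdot>\<^bsub>F\<^esub> \<one>\<^bsub>F\<^esub>"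
    using F.add.finprod_const[of "\<one>\<^bsub>F\<^esub>" "carrier G"] by (simp add: order_def)
  ultimately show False using order by simp
qed

lemma (in field) add_pow_one_neq_zero_if_coprime_order:
  assumes "finite (carrier R)" and "coprime (order R) k"
  shows "[k] \<cdot> \<one> \<noteq> \<zero>"
proof
  assume "[k] \<cdot> \<one> = \<zero>"
  then have "add.ord \<one> dvd k"
    using add.pow_eq_id by simp
  moreover have "add.ord \<one> dvd order R"
    using add.ord_dvd_group_order[of \<one>] by (simp add: order_def)
  ultimately have "add.ord \<one> = 1"
    using assms(2) by (meson coprime_common_divisor_nat)
  then show False
    using add.ord_eq_1[of \<one>] one_not_zero by simp
qed

theorem corollary3:
  fixes F :: "('a, 'b) ring_scheme" and q n :: nat and I :: "(int \<times> bool \<Rightarrow> 'a) set"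
  assumes "primepow q" and "\<not> 2 dvd q" and "n \<ge> 2" and "gcd q n = 1"
    and "field F" and "order F = q"
    and "left_ideal I (group_algebra F (dihedral n))"
  shows "I \<noteq> dual F (dihedral n) I"
proof (rule left_ideal_neq_dual)
  interpret F: field F by fact
  have "finite (carrier F)"
    using assms(1,6) primepow_gt_0_nat[of q] by (intro card_ge_0_finite) (simp add: order_def)
  moreover have "coprime (order F) (2 * n)"
    using assms(2,4,6) coprime_iff_gcd_eq_1[of q n] by simp
  ultimately show "[order (dihedral n)] \<cdot>\<^bsub>F\<^esub> \<one>\<^bsub>F\<^esub> \<noteq> \<zero>\<^bsub>F\<^esub>"
    unfolding order_dihedral by (rule F.add_pow_one_neq_zero_if_coprime_order)
  show "group (dihedral n)"
    using assms(3) by (simp add: group_dihedral)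
qed (use assms in auto)

end
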